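(* Let $\varphi_B(z)=\exp(e^z-1)$ and $\varphi_S(z)=1+\sin z$ for $z\in\mathbb D$. Then $$R_{\mathcal S^*(\varphi_S)}(\mathcal S^*(\varphi_B))=\log\bigl(1+\log(1+\sin1)\bigr).$$
   Context: Let $\mathbb D=\{z\in\mathbb C:|z|<1\}$ and let $\mathcal A$ be the class of functions $f$ analytic on $\mathbb D$ with $f(0)=0$ and $f'(0)=1$. For an analytic function $\varphi$ on $\mathbb D$ with $\varphi(0)=1$, the class $\mathcal S^*(\varphi)$ consists of all $f\in\mathcal A$ with $zf'(z)/f(z)\prec\varphi(z)$; that is, there is an analytic $\omega:\mathbb D\to\mathbb D$ with $\omega(0)=0$ such that $zf'(z)/f(z)=\varphi(\omega(z))$ on $\mathbb D$ (the quotient takes the value $1$ at $z=0$, and $f$ has no other zeros). For two such functions $\varphi_1,\varphi_2$, the sharp $\mathcal S^*(\varphi_2)$-radius of $\mathcal S^*(\varphi_1)$ is $$R_{\mathcal S^*(\varphi_2)}(\mathcal S^*(\varphi_1))=\sup\left\{r\in(0,1]: f_r(z)=\tfrac{f(rz)}{r}\text{ belongs to }\mathcal S^*(\varphi_2)\text{ for every } f\in\mathcal S^*(\varphi_1)\right\}.$$ *)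

theory Defs
  imports "HOL-Complex_Analysis.Complex_Analysis"
begin

text \<open>
  Functions on the unit disc \<open>\<D> = ball 0 1\<close> are total functions on \<^typ>\<open>complex\<close>; only their
  values on the disc matter below (the disc is open, so this includes \<^const>\<open>deriv\<close>).
\<close>

definition normalized_class :: "(complex \<Rightarrow> complex) set" where
  "normalized_class = {f. f holomorphic_on ball 0 1 \<and> f 0 = 0 \<and> deriv f 0 = 1}"

definition subordinate :: "(complex \<Rightarrow> complex) \<Rightarrow> (complex \<Rightarrow> complex) \<Rightarrow> bool" where
  "subordinate g \<phi> \<longleftrightarrow>
     (\<exists>\<omega>. \<omega> holomorphic_on ball 0 1 \<and> \<omega> ` ball 0 1 \<subseteq> ball 0 1 \<and> \<omega> 0 = 0 \<and>
          (\<forall>z\<in>ball 0 1. g z = \<phi> (\<omega> z)))"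

text \<open>The removable singularity of \<open>z f'(z) / f(z)\<close> at the origin is filled in with the value 1.\<close>

definition starlike_quotient :: "(complex \<Rightarrow> complex) \<Rightarrow> complex \<Rightarrow> complex" where
  "starlike_quotient f z = (if z = 0 then 1 else z * deriv f z / f z)"

text \<open>
  The absence of zeros other than the origin is required explicitly because division by zero
  yields 0 in HOL. The class is meant for \<open>\<phi>\<close> holomorphic on the disc with \<open>\<phi> 0 = 1\<close>.
\<close>

definition starlike_class :: "(complex \<Rightarrow> complex) \<Rightarrow> (complex \<Rightarrow> complex) set" where
  "starlike_class \<phi> =
     {f \<in> normalized_class. (\<forall>z\<in>ball 0 1 - {0}. f z \<noteq> 0) \<and> subordinate (starlike_quotient f) \<phi>}"

definition dilation :: "real \<Rightarrow> (complex \<Rightarrow> complex) \<Rightarrow> complex \<Rightarrow> complex" where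
  "dilation r f z = f (of_real r * z) / of_real r"

text \<open>The radius of \<open>starlike_class \<phi>1\<close> with respect to the target class \<open>starlike_class \<phi>2\<close>.\<close>

definition starlike_radius :: "(complex \<Rightarrow> complex) \<Rightarrow> (complex \<Rightarrow> complex) \<Rightarrow> real" where
  "starlike_radius \<phi>2 \<phi>1 =
     Sup {r \<in> {0<..1}. \<forall>f\<in>starlike_class \<phi>1. dilation r f \<in> starlike_class \<phi>2}"

definition phi_B :: "complex \<Rightarrow> complex" where
  "phi_B z = exp (exp z - 1)"

definition phi_S :: "complex \<Rightarrow> complex" where
  "phi_S z = 1 + sin z"

end

theory Submission
  imports Defs
begin

text \<open>
  Both \<open>phi_B z - 1\<close> and \<open>Arcsin z\<close> have nonnegative Taylor coefficients at the origin, so each is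
  bounded on circles by its value at the positive real point. Hence \<open>phi_B z - 1\<close> stays in the disc
  of radius \<open>sin 1\<close> for \<open>\<bar>z\<bar>\<close> below the radius, and there \<open>Arcsin (phi_B z - 1)\<close> maps into the unit
  disc, which with the Schwarz lemma gives the subordination. Sharpness comes from the function with
  \<open>z f'(z) / f(z) = phi_B z\<close>: evaluated at the critical point, a larger radius would require
  \<open>sin w = sin 1\<close> for some \<open>w\<close> in the open disc.
\<close>

text \<open>Along the ray from 0 through \<open>z\<close> the speed of \<open>F\<close> at distance
  \<open>t\<close> is at most \<open>g' t\<close>, so the mean value inequality on
  \<open>{0..norm z}\<close> applies. This yields the bound by the value at the positive real point
  without any power series.\<close>

lemma norm_diff_le_of_deriv_majorant:
  fixes F F' :: "complex \<Rightarrow> complex" and g g' :: "real \<Rightarrow> real"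
  assumes F: "\<And>z. norm z < R \<Longrightarrow> (F has_field_derivative F' z) (at z)"
    and g: "\<And>t. \<lbrakk>0 \<le> t; t < R\<rbrakk> \<Longrightarrow> (g has_real_derivative g' t) (at t)"
    and le: "\<And>z. norm z < R \<Longrightarrow> norm (F' z) \<le> g' (norm z)"
    and z: "norm z < R"
  shows "norm (F z - F 0) \<le> g (norm z) - g 0"
proof (cases "z = 0")
  case False
  define u where "u = sgn z"
  have u: "norm u = 1" "of_real (norm z) * u = z"
    using False by (simp_all add: u_def norm_sgn) (simp add: sgn_eq)
  have nt: "norm (of_real t * u) = t" if "0 \<le> t" for t
    using that u by (simp add: norm_mult)
  have dF: "((\<lambda>t. F (of_real t * u)) has_vector_derivative u * F' (of_real t * u)) (at t)"
    if "0 \<le> t" "t < R" for t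
  proof -
    have "((\<lambda>t. of_real t * u) has_vector_derivative u) (at t)"
      by (auto intro!: derivative_eq_intros)
    from field_vector_diff_chain_at[OF this F] nt that show ?thesis
      by (simp add: o_def)
  qed
  have dg: "(g has_vector_derivative g' t) (at t)" if "0 \<le> t" "t < R" for t
    using g[OF that] by (simp add: has_real_derivative_iff_has_vector_derivative)
  have "norm (F (of_real (norm z) * u) - F (of_real 0 * u)) \<le> g (norm z) - g 0"
  proof (rule differentiable_bound_general)
    show "0 < norm z" using False by simp
    show "continuous_on {0..norm z} (\<lambda>t. F (of_real t * u))"
      using z by (auto intro!: continuous_at_imp_continuous_on has_vector_derivative_continuous[OF dF])
    show "continuous_on {0..norm z} g"
      using z by (auto intro!: continuous_at_imp_continuous_on DERIV_isCont[OF g])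
    fix t assume t: "0 < t" "t < norm z"
    then show "((\<lambda>t. F (of_real t * u)) has_vector_derivative u * F' (of_real t * u)) (at t)"
      and "(g has_vector_derivative g' t) (at t)"
      using dF dg z by auto
    show "norm (u * F' (of_real t * u)) \<le> g' t"
      using le[of "of_real t * u"] nt[of t] t z u by (simp add: norm_mult)
  qed
  then show ?thesis
    by (simp add: u)
qed simp

text \<open>The derivative \<open>exp w * exp (exp w - 1)\<close> is largest on a circle at the
  positive real point: \<open>norm (exp w)\<close> and \<open>Re (exp w)\<close> are both at most
  \<open>exp (norm w)\<close>.\<close>

lemma norm_phi_B_minus_1_le: "norm (phi_B z - 1) \<le> exp (exp (norm z) - 1) - 1"
proof -
  have "norm (phi_B z - phi_B 0) \<le> exp (exp (norm z) - 1) - exp (exp 0 - 1)"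
  proof (rule norm_diff_le_of_deriv_majorant)
    show "(phi_B has_field_derivative exp w * exp (exp w - 1)) (at w)" for w
      unfolding phi_B_def[abs_def] by (auto intro!: derivative_eq_intros)
    show "((\<lambda>t. exp (exp t - 1)) has_real_derivative exp t * exp (exp t - 1)) (at t)" for t
      by (auto intro!: derivative_eq_intros)
    fix w :: complex
    have "Re (exp w) \<le> exp (norm w)"
      using complex_Re_le_cmod norm_exp order_trans by blast
    then show "norm (exp w * exp (exp w - 1)) \<le> exp (norm w) * exp (exp (norm w) - 1)"
      unfolding norm_mult by (intro mult_mono norm_exp) auto
    \<comment> \<open>The majorant holds on the whole plane, so any radius beyond
      \<open>norm z\<close> serves as \<open>R\<close>.\<close>
    show "norm z < norm z + 1" by simp
  qed
  then show ?thesis by (simp add: phi_B_def)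
qed

text \<open>The derivative of \<open>Arcsin\<close> at \<open>w\<close> is the inverse of a square
  root of \<open>1 - w\<^sup>2\<close>, and \<open>norm (1 - w\<^sup>2)\<close> is at least
  \<open>1 - (norm w)\<^sup>2\<close>.\<close>

lemma norm_Arcsin_le:
  assumes "norm z < 1"
  shows "norm (Arcsin z) \<le> arcsin (norm z)"
proof -
  have "norm (Arcsin z - Arcsin 0) \<le> arcsin (norm z) - arcsin 0"
  proof (rule norm_diff_le_of_deriv_majorant)
    show "(Arcsin has_field_derivative inverse (cos (Arcsin w))) (at w)" if "norm w < 1" for w
      using that abs_Re_le_cmod[of w] by (intro has_field_derivative_Arcsin) auto
    show "(arcsin has_real_derivative inverse (sqrt (1 - t\<^sup>2))) (at t)" if "0 \<le> t" "t < 1" for t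
      using that by (intro DERIV_arcsin) auto
    fix w :: complex assume w: "norm w < 1"
    have "1 - (norm w)\<^sup>2 \<le> norm (1 - w\<^sup>2)"
      by (metis norm_one norm_power norm_triangle_ineq2)
    also have "\<dots> = (norm (cos (Arcsin w)))\<^sup>2"
      by (simp add: cos_squared_eq flip: norm_power)
    finally have "sqrt (1 - (norm w)\<^sup>2) \<le> norm (cos (Arcsin w))"
      by (simp add: real_le_lsqrt)
    moreover have "0 < sqrt (1 - (norm w)\<^sup>2)"
      using w by (simp add: power_less_one_iff)
    ultimately show "norm (inverse (cos (Arcsin w))) \<le> inverse (sqrt (1 - (norm w)\<^sup>2))"
      by (simp add: norm_inverse le_imp_inverse_le)
  qed (use assms in auto)
  then show ?thesis by simp
qed

text \<open>Supplies the extremal function. The equation \<open>z * f' / f = \<phi>\<close> is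
  solved by \<open>z * exp h\<close> with \<open>h\<close> a primitive of
  \<open>(\<phi> z - 1) / z\<close>; the subordinating map is then the identity.\<close>

lemma exists_starlike_quotient_eq:
  assumes hol: "\<phi> holomorphic_on ball 0 1" and "\<phi> 0 = 1"
  obtains f where "f \<in> starlike_class \<phi>" "\<And>z. z \<in> ball 0 1 \<Longrightarrow> starlike_quotient f z = \<phi> z"
proof -
  \<comment> \<open>The value at 0 removes the singularity; a primitive exists because the disc is
    convex.\<close>
  define q where "q z = (if z = 0 then deriv \<phi> 0 else (\<phi> z - \<phi> 0) / (z - 0))" for z
  have "q holomorphic_on ball 0 1"
    unfolding q_def using hol by (intro pole_lemma) auto
  then obtain h where "\<And>z. z \<in> ball 0 1 \<Longrightarrow> (h has_field_derivative q z) (at z within ball 0 1)"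
    using holomorphic_convex_primitive'[of "ball 0 1" q] by auto
  then have h: "(h has_field_derivative q z) (at z)" if "z \<in> ball 0 1" for z
    using that by (metis at_within_open open_ball)
  \<comment> \<open>Subtracting \<open>h 0\<close> makes the exponential factor 1 at the origin,
    hence \<open>deriv f 0 = 1\<close>.\<close>
  define f where "f z = z * exp (h z - h 0)" for z
  have df: "(f has_field_derivative exp (h z - h 0) * \<phi> z) (at z)" if "z \<in> ball 0 1" for z
  proof -
    have "(f has_field_derivative exp (h z - h 0) + q z * exp (h z - h 0) * z) (at z)"
      unfolding f_def[abs_def] by (rule derivative_eq_intros h that refl | simp)+
    also have "exp (h z - h 0) + q z * exp (h z - h 0) * z = exp (h z - h 0) * \<phi> z"
      using \<open>\<phi> 0 = 1\<close> by (simp add: q_def field_simps)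
    finally show ?thesis .
  qed
  have deriv_f: "deriv f z = exp (h z - h 0) * \<phi> z" if "z \<in> ball 0 1" for z
    using df[OF that] by (rule DERIV_imp_deriv)
  have quot: "starlike_quotient f z = \<phi> z" if "z \<in> ball 0 1" for z
    using that deriv_f[OF that] \<open>\<phi> 0 = 1\<close> by (auto simp: starlike_quotient_def f_def)
  have "f holomorphic_on ball 0 1"
    by (auto simp: holomorphic_on_open intro!: exI df)
  moreover have "subordinate (starlike_quotient f) \<phi>"
    unfolding subordinate_def by (rule exI[of _ "\<lambda>z. z"]) (auto simp: quot)
  ultimately have "f \<in> starlike_class \<phi>"
    using deriv_f[of 0] \<open>\<phi> 0 = 1\<close>
    by (auto simp: starlike_class_def normalized_class_def f_def)
  with quot show thesis by (rule that[rotated -1])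
qed

text \<open>The inner derivative \<open>r\<close> cancels the divisor \<open>r\<close> of the
  dilation, so in the quotient a dilation merely replaces \<open>z\<close> by
  \<open>r * z\<close>.\<close>

lemma
  assumes f: "f holomorphic_on ball 0 1" and r: "0 < r" "r \<le> 1" and z: "z \<in> ball 0 1"
  shows has_field_derivative_dilation:
      "(dilation r f has_field_derivative deriv f (of_real r * z)) (at z)"
    and starlike_quotient_dilation:
      "starlike_quotient (dilation r f) z = starlike_quotient f (of_real r * z)"
proof -
  have "norm (of_real r * z) < 1"
    using r z mult_left_le_one_le[of "norm z" r] by (simp add: norm_mult)
  then have "(f has_field_derivative deriv f (of_real r * z)) (at (of_real r * z))"
    using f by (intro holomorphic_derivI[of _ "ball 0 1"]) auto
  then have *: "(f has_field_derivative deriv f (of_real r * z)) (at (z * of_real r))"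
    by (simp add: mult.commute)
  have "((\<lambda>z. f (z * of_real r)) has_field_derivative deriv f (of_real r * z) * of_real r) (at z)"
    by (rule DERIV_chain2[where f = f and g = "\<lambda>z. z * of_real r", OF *]) (auto intro!: derivative_eq_intros)
  from DERIV_cdivide[OF this, of "of_real r"]
  show d: "(dilation r f has_field_derivative deriv f (of_real r * z)) (at z)"
    using r by (simp add: dilation_def[abs_def] mult.commute)
  show "starlike_quotient (dilation r f) z = starlike_quotient f (of_real r * z)"
    using r DERIV_imp_deriv[OF d] by (simp add: starlike_quotient_def dilation_def)
qed

lemma dilation_normalized_class:
  assumes "f \<in> normalized_class" and r: "0 < r" "r \<le> 1"
  shows "dilation r f \<in> normalized_class"
proof -
  have f: "f holomorphic_on ball 0 1" "f 0 = 0" "deriv f 0 = 1"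
    using assms by (auto simp: normalized_class_def)
  have "dilation r f holomorphic_on ball 0 1"
    by (auto simp: holomorphic_on_open intro!: exI has_field_derivative_dilation f(1) r)
  moreover have "deriv (dilation r f) 0 = 1"
    using DERIV_imp_deriv[OF has_field_derivative_dilation[OF f(1) r, of 0]] f by simp
  ultimately show ?thesis
    using f by (simp add: normalized_class_def dilation_def)
qed

theorem theorem7p5:
  shows "starlike_radius phi_S phi_B = ln (1 + ln (1 + sin (1::real)))"
proof -
  define \<rho> :: real where "\<rho> = ln (1 + ln (1 + sin 1))"
  have sin1: "0 < sin (1::real)" "sin (1::real) < 1"
    using sin_gt_zero[of 1] sin_monotone_2pi[of 1 "pi/2"] pi_gt3 by auto
  \<comment> \<open>The second equation characterises \<rho>: \<open>phi_B\<close> at \<rho> equals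
    \<open>phi_S\<close> at 1.\<close>
  have \<rho>_pos: "0 < \<rho>" and exp_\<rho>: "exp (exp \<rho> - 1) = 1 + sin 1"
    using sin1 by (auto simp: \<rho>_def ln_gt_zero add_pos_pos)
  \<comment> \<open>Applying \<open>1 + x \<le> exp x\<close> twice gives \<rho> \<le>
    \<open>exp \<rho> - 1\<close> \<le> \<open>sin 1\<close> < 1.\<close>
  have "\<rho> < 1"
  proof -
    have "exp \<rho> - 1 < 1"
      using exp_\<rho> sin1 exp_ge_add_one_self[of "exp \<rho> - 1"] by linarith
    then show ?thesis
      using exp_ge_add_one_self[of \<rho>] by linarith
  qed
  have hol_B: "phi_B holomorphic_on A" for A
    unfolding phi_B_def[abs_def] by (intro holomorphic_intros)
  let ?S = "{r \<in> {0<..1}. \<forall>f\<in>starlike_class phi_B. dilation r f \<in> starlike_class phi_S}"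
  have "\<rho> \<in> ?S"
  proof (clarsimp simp: \<rho>_pos less_imp_le[OF \<open>\<rho> < 1\<close>])
    fix f assume f: "f \<in> starlike_class phi_B"
    then obtain \<omega> where hol: "\<omega> holomorphic_on ball 0 1" and \<omega>: "\<omega> ` ball 0 1 \<subseteq> ball 0 1" "\<omega> 0 = 0"
      and eq: "\<And>z. z \<in> ball 0 1 \<Longrightarrow> starlike_quotient f z = phi_B (\<omega> z)"
      by (auto simp: starlike_class_def subordinate_def)
    have holf: "f holomorphic_on ball 0 1" and f_norm: "f \<in> normalized_class"
      and nz: "\<And>z. z \<in> ball 0 1 \<Longrightarrow> z \<noteq> 0 \<Longrightarrow> f z \<noteq> 0"
      using f by (auto simp: starlike_class_def normalized_class_def)
    have \<rho>z: "norm (of_real \<rho> * z) < \<rho>" if "z \<in> ball 0 1" for z :: complex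
      using that \<rho>_pos by (simp add: norm_mult)
    \<comment> \<open>\<open>1 + v z\<close> is the quotient of the dilated function, so
      \<open>Arcsin (v z)\<close> is the candidate for the subordinating map to
      \<open>phi_S\<close>.\<close>
    define v where "v z = phi_B (\<omega> (of_real \<rho> * z)) - 1" for z
    have v: "norm (v z) < sin 1" if "z \<in> ball 0 1" for z
    proof -
      \<comment> \<open>Schwarz confines the values to the open disc of radius \<rho>, where the
        bound on \<open>phi_B\<close> stays strictly below \<open>sin 1\<close>.\<close>
      have "norm (\<omega> (of_real \<rho> * z)) \<le> norm (of_real \<rho> * z)"
        proof (rule Schwarz_Lemma(1)[OF hol \<omega>(2)])
        show "norm (\<omega> y) < 1" if "norm y < 1" for y
          using \<omega>(1) that by (auto simp: image_subset_iff)
        show "norm (of_real \<rho> * z) < 1"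
          using \<rho>z[OF that] \<open>\<rho> < 1\<close> by linarith
      qed
      with \<rho>z[OF that] have "norm (\<omega> (of_real \<rho> * z)) < \<rho>"
        by linarith
      then have "exp (exp (norm (\<omega> (of_real \<rho> * z))) - 1) - 1 < exp (exp \<rho> - 1) - 1"
        by simp
      then show ?thesis
        using norm_phi_B_minus_1_le[of "\<omega> (of_real \<rho> * z)"] exp_\<rho> by (simp add: v_def)
    qed
    have "(\<lambda>z. \<omega> (of_real \<rho> * z)) holomorphic_on ball 0 1"
      using \<rho>z \<open>\<rho> < 1\<close>
      by (intro holomorphic_on_compose_gen[OF _ hol, unfolded o_def] holomorphic_intros) fastforce
    then have hol_v: "v holomorphic_on ball 0 1"
      unfolding v_def[abs_def] phi_B_def by (intro holomorphic_intros)
    have "Arcsin holomorphic_on ball 0 1"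
      by (intro holomorphic_on_Arcsin) (auto intro: le_less_trans[OF abs_Re_le_cmod])
    then have "(\<lambda>z. Arcsin (v z)) holomorphic_on ball 0 1"
    proof (rule holomorphic_on_compose_gen[OF hol_v, unfolded o_def])
      show "v ` ball 0 1 \<subseteq> ball 0 1"
        using v less_trans[OF _ sin1(2)] by auto
    qed
    moreover have "norm (Arcsin (v z)) < 1" if "z \<in> ball 0 1" for z
    proof -
      have "norm (Arcsin (v z)) \<le> arcsin (norm (v z))"
        using v[OF that] sin1 by (intro norm_Arcsin_le) linarith
      \<comment> \<open>The strict bound on \<open>v z\<close> survives since \<open>arcsin\<close>
        is strictly increasing, which keeps \<open>Arcsin (v z)\<close> in the open disc.\<close>
      also have "\<dots> < arcsin (sin 1)"
        using v[OF that] sin1 norm_ge_zero[of "v z"] by (intro arcsin_less_mono[THEN iffD2]) linarith+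
      also have "\<dots> = 1"
        using pi_gt3 by (intro arcsin_sin) auto
      finally show ?thesis .
    qed
    moreover have "Arcsin (v 0) = 0"
      by (simp add: v_def \<omega> phi_B_def)
    moreover have "starlike_quotient (dilation \<rho> f) z = phi_S (Arcsin (v z))" if "z \<in> ball 0 1" for z
    proof -
      have "of_real \<rho> * z \<in> ball 0 1"
        using \<rho>z[OF that] \<open>\<rho> < 1\<close> by simp
      then show ?thesis
        using starlike_quotient_dilation[OF holf \<rho>_pos _ that] \<open>\<rho> < 1\<close> eq
        by (simp add: phi_S_def v_def)
    qed
    ultimately have "subordinate (starlike_quotient (dilation \<rho> f)) phi_S"
      unfolding subordinate_def by (intro exI[of _ "\<lambda>z. Arcsin (v z)"]) auto
    moreover have "dilation \<rho> f z \<noteq> 0" if "z \<in> ball 0 1" "z \<noteq> 0" for z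
      using nz[of "of_real \<rho> * z"] \<rho>z[OF that(1)] that \<rho>_pos \<open>\<rho> < 1\<close> by (simp add: dilation_def)
    ultimately show "dilation \<rho> f \<in> starlike_class phi_S"
      using dilation_normalized_class[OF f_norm \<rho>_pos] \<open>\<rho> < 1\<close> by (auto simp: starlike_class_def)
  qed
  moreover have "r \<le> \<rho>" if r: "r \<in> ?S" for r
  proof (rule ccontr)
    assume "\<not> r \<le> \<rho>"
    then have "\<rho> < r" "0 < r" "r \<le> 1"
      using r by auto
    obtain f where f: "f \<in> starlike_class phi_B"
      and quot: "\<And>z. z \<in> ball 0 1 \<Longrightarrow> starlike_quotient f z = phi_B z"
      using exists_starlike_quotient_eq[OF hol_B] by (auto simp: phi_B_def)
    \<comment> \<open>Chosen so that the dilation by \<open>r\<close> carries \<open>x\<close> to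
      \<rho>; it lies in the open disc exactly because \<rho> < \<open>r\<close>.\<close>
    define x :: complex where "x = of_real (\<rho> / r)"
    have x: "x \<in> ball 0 1" "of_real r * x = of_real \<rho>"
      using \<rho>_pos \<open>\<rho> < r\<close> by (auto simp: x_def norm_divide)
    from r f have "subordinate (starlike_quotient (dilation r f)) phi_S"
      by (auto simp: starlike_class_def)
    then obtain w where w: "norm w < 1" "starlike_quotient (dilation r f) x = phi_S w"
      using x(1) by (force simp: subordinate_def)
    have "starlike_quotient (dilation r f) x = phi_B (of_real \<rho>)"
      using f x \<rho>_pos \<open>\<rho> < 1\<close> \<open>0 < r\<close> \<open>r \<le> 1\<close>
      by (simp add: starlike_quotient_dilation quot starlike_class_def normalized_class_def)
    also have "\<dots> = of_real (exp (exp \<rho> - 1))"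
      by (simp add: phi_B_def flip: exp_of_real)
    also have "\<dots> = 1 + sin 1"
      unfolding exp_\<rho> by (simp flip: sin_of_real)
    finally have "sin w = sin 1"
      using w(2) by (simp add: phi_S_def)
    \<comment> \<open>Both \<open>w\<close> and 1 have real part strictly between
      \<open>-pi/2\<close> and \<open>pi/2\<close>, where \<open>sin\<close> is injective with
      inverse \<open>Arcsin\<close>. Hence \<open>w = 1\<close>, outside the open disc.\<close>
    moreover have "Arcsin (sin w) = w" "Arcsin (sin 1) = 1"
      using w(1) abs_Re_le_cmod[of w] pi_gt3 by (auto intro!: Arcsin_sin)
    ultimately show False
      using w(1) by simp
  qed
  ultimately show ?thesis
    unfolding starlike_radius_def \<rho>_def[symmetric] by (rule cSup_eq_maximum)
qed

end
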